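(* Let $n,m$ be positive integers. The algorithm described in the context, on input $(n,m)$, returns the sets $B(n,m)$, $I(n,m)$, $D(n,m)$ of all bracketed, all indecomposable, and all decomposable Rota-Baxter words in $R$ of degree $n$ and arity $m$, respectively. Moreover, for $n\ge 4$, $B(n,m)$ is the disjoint union of the sets of words formed in Steps 1--7 (constructed from sets $B(k,\ell)=I(k,\ell)\cup D(k,\ell)$ with $k<n$ and $\ell<m$), in accordance with the identity $$b_{n,m}=2b_{n-1,m-1}+2b_{n-1,m-2}+\sum_{k=1}^{n-2}\sum_{\ell=1}^{m-2}b_{k,\ell}\,b_{n-1-k,m-1-\ell}+2\sum_{k=1}^{n-2}\sum_{\ell=1}^{m-3}b_{k,\ell}\,b_{n-1-k,m-2-\ell}+\sum_{k=1}^{n-2}\sum_{\ell=1}^{m-4}b_{k,\ell}\,b_{n-1-k,m-3-\ell},$$ where $b_{n,m}$ is the cardinality of $B(n,m)$.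
   Context: Words are finite strings over the three symbols $x,\lfloor,\rfloor$. Let $R$ be the set consisting of the empty word $\emptyset$ together with all nonempty strings $w$ such that: (i) $w$ has equally many $\lfloor$ and $\rfloor$, and every prefix of $w$ has at least as many $\lfloor$ as $\rfloor$ (so brackets are balanced and matched into pairs in the usual way); (ii) no two $x$'s are adjacent in $w$; (iii) neither $\rfloor\lfloor$ nor $\lfloor\rfloor$ occurs as a substring of $w$; (iv) no two matched pairs of brackets are immediately nested, i.e. no substring $\lfloor\lfloor w'\rfloor\rfloor$ occurs in which the first $\lfloor$ is matched with the last $\rfloor$ and the second $\lfloor$ with the second-to-last $\rfloor$. Elements of $R$ are called Rota-Baxter words. The degree of a word is its number of matched pairs of brackets; its arity is the number of $x$'s in it. A word in $R$ of positive degree is bracketed if it begins with $\lfloor$ and ends with $\rfloor$; a bracketed word is indecomposable if its first $\lfloor$ and last $\rfloor$ are matched with each other, and decomposable otherwise. $B(n,m)$, $I(n,m)$, $D(n,m)$ are the sets of bracketed, indecomposable, decomposable words of degree $n$ and arity $m$; these sets are empty when $n\le 0$ or $m\le 0$. Juxtaposition denotes concatenation of strings. Algorithm (input: positive integers $n,m$; the sets for smaller degree used in the steps are obtained by the same algorithm): Step 0. If not ($n\le m\le 2n-1$), return three empty sets. Generate directly all bracketed (resp. indecomposable, resp. decomposable) words with degree $k\le 3$ and arity $\ell$ with $k\le\ell\le 2k-1$. If $n\le 3$, return $B(n,m),I(n,m),D(n,m)$. Step 1. For each $w\in B(n-1,m-1)$ form the two words $\lfloor x\,w\rfloor$ and $\lfloor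 w\,x\rfloor$. Step 2. For each $u\in B(n-1,m-2)$ form $\lfloor x\,u\,x\rfloor$. Step 3. For each $1\le k\le n-2$, $1\le \ell\le m-2$ and each $(v,y)\in I(k,\ell)\times B(n-1-k,m-1-\ell)$ form $\lfloor v\,x\,y\rfloor$. Step 4. For each $1\le k\le n-2$, $1\le \ell\le m-2$ and each $(v,y)\in D(k,\ell)\times B(n-1-k,m-1-\ell)$ form $\lfloor v\rfloor\,x\,y$. Step 5. For each $u\in B(n-1,m-2)$ form $\lfloor x\rfloor\,x\,u$. Step 6. For each $1\le k\le n-2$, $1\le \ell\le m-3$ and each $(v,y)\in B(k,\ell)\times B(n-1-k,m-2-\ell)$ form the two words $\lfloor x\,v\rfloor\,x\,y$ and $\lfloor v\,x\rfloor\,x\,y$. Step 7. For each $1\le k\le n-2$, $1\le \ell\le m-4$ and each $(v,y)\in B(k,\ell)\times B(n-1-k,m-3-\ell)$ form $\lfloor x\,v\,x\rfloor\,x\,y$. Step 8. Return the union of all words formed in Steps 1--3 as $I(n,m)$, the union of all words formed in Steps 4--7 as $D(n,m)$, and the union of these two sets as $B(n,m)$. *)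

theory Defs
  imports Main "HOL-Library.Sublist" "HOL-Library.Disjoint_Sets"
begin

text \<open>\<open>LB\<close> and \<open>RB\<close> stand for the left and the right floor bracket.\<close>

datatype letter = X | LB | RB

type_synonym word = "letter list"

definition balanced :: "word \<Rightarrow> bool" where
  "balanced w \<longleftrightarrow>
     count_list w LB = count_list w RB \<and>
     (\<forall>p. prefix p w \<longrightarrow> count_list p RB \<le> count_list p LB)"

text \<open>The brackets at positions \<open>i\<close> and \<open>j\<close> (counted from 0) are matched with each other iff the
  factor strictly between them is itself balanced.\<close>

definition matched :: "word \<Rightarrow> nat \<Rightarrow> nat \<Rightarrow> bool" where
  "matched w i j \<longleftrightarrow>
     i < j \<and> j < length w \<and> w ! i = LB \<and> w ! j = RB \<and>
     balanced (take (j - Suc i) (drop (Suc i) w))"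

definition RB_words :: "word set" where
  "RB_words = {[]} \<union> {w. w \<noteq> [] \<and>
     balanced w \<and>
     \<not> sublist [X, X] w \<and>
     \<not> sublist [RB, LB] w \<and> \<not> sublist [LB, RB] w \<and>
     \<not> (\<exists>i j. matched w i (Suc j) \<and> matched w (Suc i) j)}"

definition degree :: "word \<Rightarrow> nat" where
  "degree w = card {(i, j). matched w i j}"

definition arity :: "word \<Rightarrow> nat" where
  "arity w = count_list w X"

definition bracketed :: "word \<Rightarrow> bool" where
  "bracketed w \<longleftrightarrow> w \<in> RB_words \<and> 0 < degree w \<and> hd w = LB \<and> last w = RB"

definition indecomposable :: "word \<Rightarrow> bool" where
  "indecomposable w \<longleftrightarrow> bracketed w \<and> matched w 0 (length w - 1)"

definition decomposable :: "word \<Rightarrow> bool" where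
  "decomposable w \<longleftrightarrow> bracketed w \<and> \<not> matched w 0 (length w - 1)"

text \<open>The sets are empty by convention for nonpositive degree or arity. As the indices are natural
  numbers, a negative index such as \<open>m - 2\<close> for \<open>m = 1\<close> is truncated to 0, where the convention
  gives the same empty set.\<close>

definition \<B> :: "nat \<Rightarrow> nat \<Rightarrow> word set" where
  "\<B> n m = {w. 0 < n \<and> 0 < m \<and> bracketed w \<and> degree w = n \<and> arity w = m}"

definition \<I> :: "nat \<Rightarrow> nat \<Rightarrow> word set" where
  "\<I> n m = {w. 0 < n \<and> 0 < m \<and> indecomposable w \<and> degree w = n \<and> arity w = m}"

definition \<D> :: "nat \<Rightarrow> nat \<Rightarrow> word set" where
  "\<D> n m = {w. 0 < n \<and> 0 < m \<and> decomposable w \<and> degree w = n \<and> arity w = m}"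

definition \<b> :: "nat \<Rightarrow> nat \<Rightarrow> nat" where
  "\<b> n m = card (\<B> n m)"

definition enclose :: "word \<Rightarrow> word" where
  "enclose w = [LB] @ w @ [RB]"

text \<open>The steps are parametrised by the families \<open>B\<close>, \<open>I\<close>, \<open>D\<close> of sets they draw from, so that
  they can be fed the recursively computed sets as well as the sets \<open>\<B>\<close>, \<open>\<I>\<close>, \<open>\<D>\<close>.\<close>

type_synonym family = "nat \<Rightarrow> nat \<Rightarrow> word set"

definition step1 :: "family \<Rightarrow> family" where
  "step1 B n m =
     {enclose ([X] @ w) | w. w \<in> B (n - 1) (m - 1)} \<union>
     {enclose (w @ [X]) | w. w \<in> B (n - 1) (m - 1)}"

definition step2 :: "family \<Rightarrow> family" where
  "step2 B n m = {enclose ([X] @ u @ [X]) | u. u \<in> B (n - 1) (m - 2)}"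

definition step3 :: "family \<Rightarrow> family \<Rightarrow> family" where
  "step3 I B n m =
     {enclose (v @ [X] @ y) | k l v y.
        k \<in> {1..n - 2} \<and> l \<in> {1..m - 2} \<and>
        v \<in> I k l \<and> y \<in> B (n - 1 - k) (m - 1 - l)}"

definition step4 :: "family \<Rightarrow> family \<Rightarrow> family" where
  "step4 D B n m =
     {enclose v @ [X] @ y | k l v y.
        k \<in> {1..n - 2} \<and> l \<in> {1..m - 2} \<and>
        v \<in> D k l \<and> y \<in> B (n - 1 - k) (m - 1 - l)}"

definition step5 :: "family \<Rightarrow> family" where
  "step5 B n m = {enclose [X] @ [X] @ u | u. u \<in> B (n - 1) (m - 2)}"

definition step6 :: "family \<Rightarrow> family" where
  "step6 B n m =
     {enclose ([X] @ v) @ [X] @ y | k l v y.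
        k \<in> {1..n - 2} \<and> l \<in> {1..m - 3} \<and>
        v \<in> B k l \<and> y \<in> B (n - 1 - k) (m - 2 - l)} \<union>
     {enclose (v @ [X]) @ [X] @ y | k l v y.
        k \<in> {1..n - 2} \<and> l \<in> {1..m - 3} \<and>
        v \<in> B k l \<and> y \<in> B (n - 1 - k) (m - 2 - l)}"

definition step7 :: "family \<Rightarrow> family" where
  "step7 B n m =
     {enclose ([X] @ v @ [X]) @ [X] @ y | k l v y.
        k \<in> {1..n - 2} \<and> l \<in> {1..m - 4} \<and>
        v \<in> B k l \<and> y \<in> B (n - 1 - k) (m - 3 - l)}"

text \<open>Direct generation is by exhaustive search: a balanced word of degree \<open>n\<close> and arity \<open>m\<close> has
  length \<open>2 * n + m\<close>.\<close>

definition generate :: "(word \<Rightarrow> bool) \<Rightarrow> nat \<Rightarrow> nat \<Rightarrow> word set" where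
  "generate P n m =
     set (filter (\<lambda>w. P w \<and> degree w = n \<and> arity w = m) (List.n_lists (2 * n + m) [X, LB, RB]))"

text \<open>The steps only consult the families at degrees below \<open>n\<close>; these congruence rules make that
  visible to the termination proof of the algorithm.\<close>

context
  fixes n n' m m' :: nat
  assumes nm: "n = n'" "m = m'"
begin

lemma step1_cong [fundef_cong]:
  assumes "\<And>k l. k \<le> n' - 1 \<Longrightarrow> B k l = B' k l"
  shows "step1 B n m = step1 B' n' m'"
  using assms nm by (simp add: step1_def)

lemma step2_cong [fundef_cong]:
  assumes "\<And>k l. k \<le> n' - 1 \<Longrightarrow> B k l = B' k l"
  shows "step2 B n m = step2 B' n' m'"
  using assms nm by (simp add: step2_def)

lemma step3_cong [fundef_cong]:
  assumes "\<And>k l. k \<le> n' - 1 \<Longrightarrow> I k l = I' k l" "\<And>k l. k \<le> n' - 1 \<Longrightarrow> B k l = B' k l"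
  shows "step3 I B n m = step3 I' B' n' m'"
proof -
  have "k \<le> n' - 1" "n' - 1 - k \<le> n' - 1" if "k \<in> {1..n' - 2}" for k
    using that by auto
  with assms nm show ?thesis
    unfolding step3_def by (simp cong: conj_cong)
qed

lemma step4_cong [fundef_cong]:
  assumes "\<And>k l. k \<le> n' - 1 \<Longrightarrow> D k l = D' k l" "\<And>k l. k \<le> n' - 1 \<Longrightarrow> B k l = B' k l"
  shows "step4 D B n m = step4 D' B' n' m'"
proof -
  have "k \<le> n' - 1" "n' - 1 - k \<le> n' - 1" if "k \<in> {1..n' - 2}" for k
    using that by auto
  with assms nm show ?thesis
    unfolding step4_def by (simp cong: conj_cong)
qed

lemma step5_cong [fundef_cong]:
  assumes "\<And>k l. k \<le> n' - 1 \<Longrightarrow> B k l = B' k l"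
  shows "step5 B n m = step5 B' n' m'"
  using assms nm by (simp add: step5_def)

lemma step6_cong [fundef_cong]:
  assumes "\<And>k l. k \<le> n' - 1 \<Longrightarrow> B k l = B' k l"
  shows "step6 B n m = step6 B' n' m'"
proof -
  have "k \<le> n' - 1" "n' - 1 - k \<le> n' - 1" if "k \<in> {1..n' - 2}" for k
    using that by auto
  with assms nm show ?thesis
    unfolding step6_def by (simp cong: conj_cong)
qed

lemma step7_cong [fundef_cong]:
  assumes "\<And>k l. k \<le> n' - 1 \<Longrightarrow> B k l = B' k l"
  shows "step7 B n m = step7 B' n' m'"
proof -
  have "k \<le> n' - 1" "n' - 1 - k \<le> n' - 1" if "k \<in> {1..n' - 2}" for k
    using that by auto
  with assms nm show ?thesis
    unfolding step7_def by (simp cong: conj_cong)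
qed

end

text \<open>The algorithm returns the triple of the bracketed, the indecomposable and the decomposable
  words, in this order. The test \<open>m + 1 \<le> 2 * n\<close> is \<open>m \<le> 2 * n - 1\<close> without truncated subtraction;
  in particular the result is three empty sets if \<open>n = 0\<close> or \<open>m = 0\<close>.\<close>

function algorithm :: "nat \<Rightarrow> nat \<Rightarrow> word set \<times> word set \<times> word set" where
  "algorithm n m =
    (if \<not> (n \<le> m \<and> m + 1 \<le> 2 * n) then ({}, {}, {})
     else if n \<le> 3 then
       (generate bracketed n m, generate indecomposable n m, generate decomposable n m)
     else
       let I =
             step1 (\<lambda>k l. fst (algorithm k l)) n m \<union>
             step2 (\<lambda>k l. fst (algorithm k l)) n m \<union>
             step3 (\<lambda>k l. fst (snd (algorithm k l))) (\<lambda>k l. fst (algorithm k l)) n m;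
           D =
             step4 (\<lambda>k l. snd (snd (algorithm k l))) (\<lambda>k l. fst (algorithm k l)) n m \<union>
             step5 (\<lambda>k l. fst (algorithm k l)) n m \<union>
             step6 (\<lambda>k l. fst (algorithm k l)) n m \<union>
             step7 (\<lambda>k l. fst (algorithm k l)) n m
       in (I \<union> D, I, D))"
  by pat_completeness auto
termination
  by (relation "measure fst") auto

declare algorithm.simps [simp del]

end

theory Submission
  imports Defs
begin

text \<open>A Rota-Baxter word is determined by peeling off its outermost structure. A nonempty one is
  \<open>x\<close>, a bracketed word \<open>u\<close>, or a bracketed word with an \<open>x\<close> attached at the left, at the right or at
  both ends (\<open>RB_words_nonempty_cases\<close>): two \<open>x\<close> cannot be adjacent, so what remains
  after removing an \<open>x\<close> from either end is empty or begins and ends with a bracket.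

  An indecomposable word is \<open>\<lfloor>a\<rfloor>\<close> for a nonempty Rota-Baxter word \<open>a\<close>, and the prohibition of
  immediate nesting says exactly that \<open>a\<close> is not itself indecomposable. So \<open>a\<close> is \<open>x\<close>, one of the
  words \<open>x u\<close>, \<open>u x\<close>, \<open>x u x\<close> with \<open>u\<close> bracketed, or decomposable. In a decomposable word the first
  bracket closes before the end, and the next letter can be neither kind of bracket; so the word
  is \<open>v x y\<close> with \<open>v\<close> indecomposable and \<open>y\<close> bracketed (\<open>decomposable_iff\<close>). Combining the two
  descriptions, the indecomposable words of degree at least 2 are what the first three steps form, and
  the decomposable words are \<open>\<lfloor>a\<rfloor> x y\<close> with \<open>a\<close> of one of the five kinds, which is what the other
  four steps form. The same descriptions yield \<open>n \<le> m \<le> 2 n - 1\<close> for the degree \<open>n\<close> and the arity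
  \<open>m\<close> of a bracketed word, so that cutting off the other inputs loses nothing, and correctness of the
  algorithm follows by induction on the degree.

  Every word so formed is \<open>\<lfloor>a\<rfloor> r\<close> with \<open>a\<close> balanced, and such a factorisation is unique
  (\<open>enclose_append_inject\<close>). Whether \<open>r\<close> is empty, together with the occurrences of \<open>x\<close> at the ends
  of \<open>a\<close>, tells which step formed the word, hence the steps are disjoint; and within a step the
  ingredients can be read off from \<open>a\<close> and \<open>r\<close>, hence the words can be counted by their ingredients.
  The double sums of the steps that draw from \<open>\<I>\<close> and from \<open>\<D>\<close> add up to a sum over \<open>\<B>\<close>.\<close>

section \<open>Balanced words\<close>

lemma balanced_iff_take:
  "balanced w \<longleftrightarrow> count_list w LB = count_list w RB \<and>
     (\<forall>k. count_list (take k w) RB \<le> count_list (take k w) LB)"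
proof -
  have "prefix p w \<longleftrightarrow> (\<exists>k. p = take k w)" for p
    by (metis append_eq_conv_conj prefix_def take_is_prefix)
  then show ?thesis
    unfolding balanced_def by auto
qed

lemma balanced_count: "balanced w \<Longrightarrow> count_list w RB = count_list w LB"
  by (simp add: balanced_def)

lemma balanced_take: "balanced w \<Longrightarrow> count_list (take k w) RB \<le> count_list (take k w) LB"
  by (simp add: balanced_iff_take)

lemma balanced_drop:
  assumes "balanced w"
  shows "count_list (drop k w) LB \<le> count_list (drop k w) RB"
proof -
  have "count_list w a = count_list (take k w) a + count_list (drop k w) a" for a
    by (metis append_take_drop_id count_list_append)
  then show ?thesis
    using balanced_count[OF assms] balanced_take[OF assms, of k] by fastforce
qed

lemma balanced_Nil [simp]: "balanced []"
  by (simp add: balanced_iff_take)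

lemma balanced_X [simp]: "balanced [X]"
  by (simp add: balanced_iff_take take_Cons')

lemma balanced_append:
  assumes "balanced u"
  shows "balanced (u @ v) \<longleftrightarrow> balanced v"
proof
  assume uv: "balanced (u @ v)"
  show "balanced v"
    unfolding balanced_iff_take
  proof (intro conjI allI)
    show "count_list v LB = count_list v RB"
      using balanced_count[OF uv] balanced_count[OF assms] by simp
    show "count_list (take k v) RB \<le> count_list (take k v) LB" for k
      using balanced_take[OF uv, of "length u + k"] balanced_count[OF assms] by simp
  qed
next
  assume v: "balanced v"
  show "balanced (u @ v)"
    unfolding balanced_iff_take
    using balanced_count[OF v] balanced_count[OF assms] balanced_take[OF v] balanced_take[OF assms]
    by (auto intro: add_mono)
qed

lemma balanced_append_right:
  assumes "balanced v"
  shows "balanced (u @ v) \<longleftrightarrow> balanced u"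
proof
  assume uv: "balanced (u @ v)"
  show "balanced u"
    unfolding balanced_iff_take
  proof (intro conjI allI)
    show "count_list u LB = count_list u RB"
      using balanced_count[OF uv] balanced_count[OF assms] by simp
    show "count_list (take k u) RB \<le> count_list (take k u) LB" for k
      using balanced_take[OF uv, of "min k (length u)"] by (cases "k \<le> length u") (auto simp: min_def)
  qed
qed (use assms in \<open>simp add: balanced_append\<close>)

lemma balanced_Cons_X [simp]: "balanced (X # w) \<longleftrightarrow> balanced w"
  using balanced_append[of "[X]" w] by simp

lemma balanced_snoc_X [simp]: "balanced (w @ [X]) \<longleftrightarrow> balanced w"
  by (simp add: balanced_append_right)

lemma balanced_enclose:
  assumes "balanced u"
  shows "balanced (enclose u)"
  unfolding balanced_iff_take
proof (intro conjI allI)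
  show "count_list (enclose u) LB = count_list (enclose u) RB"
    using balanced_count[OF assms] by (simp add: enclose_def)
  show "count_list (take k (enclose u)) RB \<le> count_list (take k (enclose u)) LB" for k
  proof -
    have "count_list (take l [RB]) RB \<le> 1" "count_list (take l [RB]) LB = 0" for l
      by (auto simp: take_Cons')
    then show ?thesis
      using balanced_take[OF assms, of "k - 1"]
      by (auto simp: enclose_def take_Cons' simp flip: Suc_eq_plus1 intro: add_le_mono)
  qed
qed

lemma hd_balanced: "balanced w \<Longrightarrow> w \<noteq> [] \<Longrightarrow> hd w \<noteq> RB"
  using balanced_take[of w 1] by (cases w) auto

lemma last_balanced: "balanced w \<Longrightarrow> w \<noteq> [] \<Longrightarrow> last w \<noteq> LB"
  using balanced_drop[of w "length w - 1"] by (cases w rule: rev_cases) auto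

text \<open>First-return decomposition: the first bracket closes where the number of closing brackets
  first exceeds the number of opening ones in the rest of the word.\<close>

lemma balanced_LB_cases:
  assumes "balanced w" "w \<noteq> []" "hd w = LB"
  obtains u v where "w = enclose u @ v" "balanced u" "balanced v"
proof -
  obtain t where w: "w = LB # t"
    using assms by (cases w) auto
  let ?P = "\<lambda>k. count_list (take k t) LB < count_list (take k t) RB"
  \<comment> \<open>\<open>t\<close> has a surplus of one closing bracket, so it has a shortest prefix with a surplus.\<close>
  define k where "k = (LEAST k. ?P k)"
  have "?P (length t)"
    using balanced_count[OF assms(1)] by (simp add: w)
  then have Pk: "?P k"
    unfolding k_def by (rule LeastI)
  have least: "\<not> ?P j" if "j < k" for j
    using that unfolding k_def by (rule not_less_Least)
  from Pk obtain j where k: "k = Suc j"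
    by (cases k) auto
  have j: "j < length t"
    using Pk least[of j] by (cases "j < length t") (auto simp: k)
  have take_k: "take k t = take j t @ [t ! j]"
    using j by (simp add: k take_Suc_conv_app_nth)
  have tj: "t ! j = RB" and eq: "count_list (take j t) LB = count_list (take j t) RB"
    using Pk least[of j] unfolding take_k by (auto simp: k split: if_splits)
  have u: "balanced (take j t)"
    unfolding balanced_iff_take
    using eq least by (auto simp: k min_def) (metis leI less_Suc_eq_le nat_le_linear)
  have w_eq: "w = enclose (take j t) @ drop k t"
    by (metis append.assoc append_Cons append_Nil append_take_drop_id enclose_def take_k tj w)
  moreover have "balanced (drop k t)"
    using assms(1) balanced_enclose[OF u] by (simp add: w_eq balanced_append)
  ultimately show ?thesis
    using u that by blast
qed

lemma balanced_induct [consumes 1, case_names Nil X enclose]: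
  assumes "balanced w"
    and "P []"
    and "\<And>w. balanced w \<Longrightarrow> P w \<Longrightarrow> P (X # w)"
    and "\<And>u v. balanced u \<Longrightarrow> balanced v \<Longrightarrow> P u \<Longrightarrow> P v \<Longrightarrow> P (enclose u @ v)"
  shows "P w"
  using assms(1)
proof (induction w rule: length_induct)
  case (1 w)
  show ?case
  proof (cases w)
    case Nil
    then show ?thesis using assms(2) by simp
  next
    case (Cons a w')
    show ?thesis
    proof (cases a)
      case X
      then show ?thesis using 1 Cons assms(3)[of w'] by simp
    next
      case LB
      then obtain u v where "w = enclose u @ v" "balanced u" "balanced v"
        using balanced_LB_cases[OF "1.prems"] Cons by auto
      then show ?thesis using 1 assms(4)[of u v] by (simp add: enclose_def)
    next
      case RB
      then show ?thesis using hd_balanced[OF "1.prems"] Cons by simp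
    qed
  qed
qed

text \<open>The bracket matching the first letter is determined by the word: were one of the two balanced
  parts longer, its excess over the other would be balanced and start with a closing bracket.\<close>

lemma enclose_append_inject:
  assumes "balanced u" "balanced u'"
  shows "enclose u @ v = enclose u' @ v' \<longleftrightarrow> u = u' \<and> v = v'"
proof
  have *: "a = b" if "balanced a" "balanced b" "length a \<le> length b" "a @ RB # v = b @ RB # v'"
    for a b v v'
  proof (rule ccontr)
    assume "a \<noteq> b"
    with that obtain c where c: "b = a @ c" "c \<noteq> []" "RB # v = c @ RB # v'"
      by (auto simp: append_eq_append_conv2)
    then have "balanced c" "hd c = RB"
      using that(1,2) by (auto simp: balanced_append neq_Nil_conv)
    then show False
      using hd_balanced c by blast
  qed
  assume "enclose u @ v = enclose u' @ v'"
  then have "u @ RB # v = u' @ RB # v'"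
    by (simp add: enclose_def)
  moreover from this have "u = u'"
    using *[of u u' v v'] *[of u' u v' v] assms by (metis nat_le_linear)
  ultimately show "u = u' \<and> v = v'"
    by simp
qed auto

lemma enclose_inject [simp]: "enclose u = enclose v \<longleftrightarrow> u = v"
  by (simp add: enclose_def)

lemma enclose_simps [simp]:
  "enclose u \<noteq> []" "hd (enclose u) = LB" "last (enclose u) = RB"
  "length (enclose u) = length u + 2"
  by (auto simp: enclose_def)

section \<open>Matched brackets\<close>

lemma matched_shift: "matched (a @ w) (length a + i) (length a + j) \<longleftrightarrow> matched w i j"
  by (auto simp: matched_def nth_append)

lemma matched_append_left: "j < length w \<Longrightarrow> matched (w @ v) i j \<longleftrightarrow> matched w i j"
  by (auto simp: matched_def nth_append)

lemma matched_bound: "matched w i j \<Longrightarrow> i < j \<and> j < length w"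
  by (simp add: matched_def)

text \<open>A balanced factor is closed under matching. If the partner of an opening bracket lay beyond
  \<open>u\<close>, the rest of \<open>u\<close> after that bracket would have no surplus of closing brackets, being a prefix
  of a balanced word; with the opening bracket itself, a suffix of \<open>u\<close> would then have too few.\<close>

lemma matched_within_balanced:
  assumes u: "balanced u" and m: "matched (u @ v) i j" and i: "i < length u"
  shows "j < length u"
proof (rule ccontr)
  assume "\<not> j < length u"
  then have j: "length u \<le> j" by simp
  let ?in = "take (j - Suc i) (drop (Suc i) (u @ v))"
  have bal: "balanced ?in" and ui: "u ! i = LB"
    using m i by (auto simp: matched_def nth_append)
  have "take (length u - Suc i) ?in = drop (Suc i) u"
    using i j by (simp add: min_def)
  then have "count_list (drop (Suc i) u) RB \<le> count_list (drop (Suc i) u) LB"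
    using balanced_take[OF bal, of "length u - Suc i"] by simp
  moreover have "drop i u = LB # drop (Suc i) u"
    using i ui by (metis Cons_nth_drop_Suc)
  ultimately show False
    using balanced_drop[OF u, of i] by simp
qed

lemma matched_append:
  assumes "balanced u"
  shows "matched (u @ v) i j \<longleftrightarrow>
    matched u i j \<or> (\<exists>i' j'. i = length u + i' \<and> j = length u + j' \<and> matched v i' j')"
proof (cases "i < length u")
  case True
  then have "matched (u @ v) i j \<longleftrightarrow> matched u i j"
    using matched_within_balanced[OF assms, of v i j] matched_append_left[of j u v i]
      matched_bound[of u i j] by blast
  then show ?thesis using True by auto
next
  case False
  then obtain i' where i: "i = length u + i'"
    by (metis le_add_diff_inverse leI)
  have "\<not> matched u i j"
    using False by (auto simp: matched_def)
  moreover have "\<exists>j'. j = length u + j'" if "matched (u @ v) i j"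
    using matched_bound[OF that] False by (intro exI[of _ "j - length u"]) simp
  ultimately show ?thesis
    using matched_shift[of u v i'] by (auto simp: i)
qed

lemma matched_enclose:
  assumes u: "balanced u"
  shows "matched (enclose u) i j \<longleftrightarrow>
    i = 0 \<and> j = Suc (length u) \<or> (\<exists>i' j'. i = Suc i' \<and> j = Suc j' \<and> matched u i' j')"
proof (cases i)
  case 0
  have "j = Suc (length u)" if m: "matched (enclose u) 0 j"
  proof (rule ccontr)
    assume "j \<noteq> Suc (length u)"
    with matched_bound[OF m] obtain j' where j: "j = Suc j'" and lt: "j' < length u"
      by (cases j) auto
    have "balanced (take j' u)" "u ! j' = RB"
      using m lt by (auto simp: matched_def enclose_def j nth_append)
    then show False
      using balanced_take[OF u, of "Suc j'"] balanced_count[of "take j' u"] lt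
      by (simp add: take_Suc_conv_app_nth)
  qed
  moreover have "matched (enclose u) 0 (Suc (length u))"
    using u by (simp add: matched_def enclose_def nth_append)
  ultimately show ?thesis using 0 by auto
next
  case (Suc i')
  have "\<exists>j'. j = Suc j'" if "matched (enclose u) i j"
    using matched_bound[OF that] by (cases j) auto
  moreover have "matched (enclose u) (Suc i') (Suc j') \<longleftrightarrow> matched u i' j'" for j'
  proof -
    have "matched (enclose u) (Suc i') (Suc j') \<longleftrightarrow> matched (u @ [RB]) i' j'"
      using matched_shift[of "[LB]" "u @ [RB]" i' j'] by (simp add: enclose_def)
    also have "\<dots> \<longleftrightarrow> matched u i' j'"
      using matched_append[OF u, of "[RB]" i' j'] by (auto simp: matched_def)
    finally show ?thesis .
  qed
  ultimately show ?thesis using Suc by auto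
qed

lemma finite_matched: "finite {(i, j). matched w i j}"
  by (rule finite_subset[of _ "{..<length w} \<times> {..<length w}"]) (auto dest: matched_bound)

lemma degree_append:
  assumes "balanced u"
  shows "degree (u @ v) = degree u + degree v"
proof -
  let ?M = "\<lambda>w. {(i, j). matched w i j}"
  let ?f = "\<lambda>(i, j). (length u + i, length u + j)"
  have "?M (u @ v) = ?M u \<union> ?f ` ?M v"
    by (auto simp: matched_append[OF assms] image_iff)
  moreover have "?M u \<inter> ?f ` ?M v = {}"
    by (auto dest: matched_bound)
  moreover have "inj_on ?f (?M v)"
    by (auto simp: inj_on_def)
  ultimately show ?thesis
    unfolding degree_def by (simp add: card_Un_disjoint card_image finite_matched)
qed

lemma degree_enclose:
  assumes "balanced u"
  shows "degree (enclose u) = Suc (degree u)"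
proof -
  let ?M = "\<lambda>w. {(i, j). matched w i j}"
  let ?f = "\<lambda>(i, j). (Suc i, Suc j)"
  have "?M (enclose u) = insert (0, Suc (length u)) (?f ` ?M u)"
    by (auto simp: matched_enclose[OF assms] image_iff)
  moreover have "(0, Suc (length u)) \<notin> ?f ` ?M u"
    by auto
  moreover have "inj_on ?f (?M u)"
    by (auto simp: inj_on_def)
  ultimately show ?thesis
    unfolding degree_def by (simp add: card_image finite_matched)
qed

text \<open>Since the degree counts pairs, this says that every opening bracket of a balanced word has
  exactly one partner.\<close>

lemma degree_eq_count: "balanced w \<Longrightarrow> degree w = count_list w LB"
proof (induction w rule: balanced_induct)
  case Nil
  then show ?case by (simp add: degree_def matched_def)
next
  case (X w)
  have no_match: "\<not> matched [X] i j" for i j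
    by (auto simp: matched_def)
  have "degree [X] = 0"
    by (simp add: degree_def no_match)
  then show ?case
    using X degree_append[of "[X]" w] by simp
next
  case (enclose u v)
  then show ?case
    using degree_append[OF balanced_enclose, of u v] degree_enclose[of u]
    by (simp add: enclose_def)
qed

lemma arity_simps [simp]:
  "arity [] = 0" "arity (X # w) = Suc (arity w)"
  "arity (u @ v) = arity u + arity v" "arity (enclose u) = arity u"
  by (simp_all add: arity_def enclose_def)

lemma length_balanced:
  assumes "balanced w"
  shows "length w = 2 * degree w + arity w"
proof -
  have "length w = count_list w X + count_list w LB + count_list w RB"
  proof (induction w)
    case (Cons a w)
    then show ?case by (cases a) auto
  qed simp
  then show ?thesis
    using balanced_count[OF assms] degree_eq_count[OF assms] by (simp add: arity_def)
qed

section \<open>Rota-Baxter words\<close>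

text \<open>The local conditions on a Rota-Baxter word, as a relation between adjacent letters; a word
  \<open>u @ v\<close> satisfies them iff \<open>u\<close> and \<open>v\<close> do and the letters at the junction are compatible.\<close>

definition compatible :: "letter \<Rightarrow> letter \<Rightarrow> bool" where
  "compatible a b \<longleftrightarrow> (a, b) \<notin> {(X, X), (RB, LB), (LB, RB)}"

definition immediately_nested :: "word \<Rightarrow> bool" where
  "immediately_nested w \<longleftrightarrow> (\<exists>i j. matched w i (Suc j) \<and> matched w (Suc i) j)"

lemma sublist_pair_iff: "sublist [a, b] w \<longleftrightarrow> (\<exists>i. Suc i < length w \<and> w ! i = a \<and> w ! Suc i = b)"
proof
  assume "sublist [a, b] w"
  then obtain p s where "w = p @ [a, b] @ s"
    by (auto simp: sublist_def)
  then show "\<exists>i. Suc i < length w \<and> w ! i = a \<and> w ! Suc i = b"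
    by (intro exI[of _ "length p"]) (simp add: nth_append)
next
  assume "\<exists>i. Suc i < length w \<and> w ! i = a \<and> w ! Suc i = b"
  then obtain i where "Suc i < length w" "w ! i = a" "w ! Suc i = b"
    by blast
  then have "w = take i w @ [a, b] @ drop (Suc (Suc i)) w"
    by (metis Cons_nth_drop_Suc Suc_lessD append_Cons append_Nil append_take_drop_id)
  then show "sublist [a, b] w"
    unfolding sublist_def by blast
qed

lemma compatible_iff_no_sublist:
  "successively compatible w \<longleftrightarrow>
     \<not> sublist [X, X] w \<and> \<not> sublist [RB, LB] w \<and> \<not> sublist [LB, RB] w"
  unfolding successively_conv_nth sublist_pair_iff by (auto simp: compatible_def)

lemma RB_words_iff:
  "w \<in> RB_words \<longleftrightarrow> balanced w \<and> successively compatible w \<and> \<not> immediately_nested w"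
  by (auto simp: RB_words_def compatible_iff_no_sublist immediately_nested_def matched_def)

lemma RB_words_balanced: "w \<in> RB_words \<Longrightarrow> balanced w"
  by (simp add: RB_words_iff)

lemma Nil_in_RB_words [simp]: "[] \<in> RB_words"
  by (simp add: RB_words_def)

lemma immediately_nested_append:
  assumes "balanced u"
  shows "immediately_nested (u @ v) \<longleftrightarrow> immediately_nested u \<or> immediately_nested v"
proof
  assume "immediately_nested (u @ v)"
  then obtain i j where m: "matched (u @ v) i (Suc j)" "matched (u @ v) (Suc i) j"
    by (auto simp: immediately_nested_def)
  show "immediately_nested u \<or> immediately_nested v"
  proof (cases "i < length u")
    case True
    then have "Suc j < length u"
      using matched_within_balanced[OF assms m(1)] by simp
    then show ?thesis
      using m matched_append_left by (metis Suc_lessD immediately_nested_def)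
  next
    case False
    then obtain i' where i: "i = length u + i'"
      by (metis le_add_diff_inverse leI)
    obtain j' where j: "j = length u + j'"
      using False matched_bound[OF m(2)]
        by (metis Suc_lessD leI le_add_diff_inverse le_less_trans less_imp_le_nat)
    show ?thesis
      using m matched_shift[of u v i' "Suc j'"] matched_shift[of u v "Suc i'" j']
      by (auto simp: i j immediately_nested_def)
  qed
next
  assume "immediately_nested u \<or> immediately_nested v"
  then show "immediately_nested (u @ v)"
    unfolding immediately_nested_def
    using matched_append[OF assms, of v] by (metis add_Suc_right)
qed

text \<open>Enclosing a word creates only one new nested pair of pairs: the new outer brackets around the
  first and last letter of the word, if these match each other.\<close>

lemma immediately_nested_enclose:
  assumes "balanced u"
  shows "immediately_nested (enclose u) \<longleftrightarrow>
    immediately_nested u \<or> matched u 0 (length u - 1)"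
proof
  assume "immediately_nested (enclose u)"
  then show "immediately_nested u \<or> matched u 0 (length u - 1)"
    unfolding immediately_nested_def matched_enclose[OF assms]
    by (auto dest: matched_bound) (metis One_nat_def diff_Suc_1)
next
  assume "immediately_nested u \<or> matched u 0 (length u - 1)"
  then show "immediately_nested (enclose u)"
  proof
    assume "immediately_nested u"
    then show ?thesis
      unfolding immediately_nested_def matched_enclose[OF assms] by blast
  next
    assume m: "matched u 0 (length u - 1)"
    then have "length u = Suc (length u - 1)"
      using matched_bound by fastforce
    then show ?thesis
      using m unfolding immediately_nested_def matched_enclose[OF assms]
      by (intro exI[of _ 0] exI[of _ "length u"]) auto
  qed
qed

lemma RB_words_append:
  assumes "balanced u" "balanced v"
  shows "u @ v \<in> RB_words \<longleftrightarrow>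
    u \<in> RB_words \<and> v \<in> RB_words \<and> (u = [] \<or> v = [] \<or> compatible (last u) (hd v))"
  using assms
  by (auto simp: RB_words_iff balanced_append immediately_nested_append successively_append_iff)

lemma X_in_RB_words [simp]: "[X] \<in> RB_words"
  by (simp add: RB_words_iff immediately_nested_def matched_def)

lemma RB_words_Cons_X: "X # w \<in> RB_words \<longleftrightarrow> w \<in> RB_words \<and> (w = [] \<or> hd w \<noteq> X)"
proof (cases "balanced w")
  case True
  then show ?thesis
    using RB_words_append[of "[X]" w] by (auto simp: compatible_def)
qed (auto simp: RB_words_iff)

lemma RB_words_snoc_X: "w @ [X] \<in> RB_words \<longleftrightarrow> w \<in> RB_words \<and> (w = [] \<or> last w \<noteq> X)"
proof (cases "balanced w")
  case True
  then show ?thesis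
    using RB_words_append[of w "[X]"] by (auto simp: compatible_def)
qed (auto simp: RB_words_iff)

lemma RB_words_enclose:
  assumes "balanced u"
  shows "enclose u \<in> RB_words \<longleftrightarrow> u \<in> RB_words \<and> u \<noteq> [] \<and> \<not> matched u 0 (length u - 1)"
proof -
  have "successively compatible (enclose u) \<longleftrightarrow> successively compatible u \<and> u \<noteq> []"
  proof (cases "u = []")
    case True
    then show ?thesis by (simp add: enclose_def compatible_def)
  next
    case False
    then show ?thesis
      using hd_balanced[OF assms] last_balanced[OF assms]
      by (auto simp: enclose_def successively_append_iff successively_Cons compatible_def)
  qed
  then show ?thesis
    using assms balanced_enclose by (auto simp: RB_words_iff immediately_nested_enclose)
qed

section \<open>Bracketed words\<close>

lemma bracketed_iff: "bracketed w \<longleftrightarrow> w \<in> RB_words \<and> w \<noteq> [] \<and> hd w = LB \<and> last w = RB"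
proof -
  have "0 < degree w" if "w \<in> RB_words" "w \<noteq> []" "hd w = LB"
    using that degree_eq_count[OF RB_words_balanced] by (cases w) auto
  moreover have "degree [] = 0"
    by (simp add: degree_eq_count)
  ultimately show ?thesis
    by (auto simp: bracketed_def)
qed

lemma bracketedD:
  assumes "bracketed w"
  shows "w \<in> RB_words" "balanced w" "w \<noteq> []" "hd w = LB" "last w = RB"
  using assms by (auto simp: bracketed_iff RB_words_balanced)

lemma bracketed_cases: "bracketed w \<longleftrightarrow> indecomposable w \<or> decomposable w"
  by (auto simp: indecomposable_def decomposable_def)

lemma indecomposable_not_decomposable: "indecomposable w \<Longrightarrow> \<not> decomposable w"
  by (simp add: indecomposable_def decomposable_def)

lemma matched_iff_indecomposable:
  assumes "u \<in> RB_words"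
  shows "matched u 0 (length u - 1) \<longleftrightarrow> indecomposable u"
proof -
  have "hd u = LB \<and> last u = RB \<and> u \<noteq> []" if "matched u 0 (length u - 1)"
    using that by (cases "u = []") (auto simp: matched_def hd_conv_nth last_conv_nth)
  then show ?thesis
    using assms by (auto simp: indecomposable_def bracketed_iff)
qed

lemma indecomposable_enclose:
  assumes "balanced u"
  shows "indecomposable (enclose u) \<longleftrightarrow> u \<in> RB_words \<and> u \<noteq> [] \<and> \<not> indecomposable u"
  using assms matched_enclose[OF assms, of 0 "Suc (length u)"] matched_iff_indecomposable[of u]
  by (auto simp: indecomposable_def[of "enclose u"] bracketed_iff RB_words_enclose)

text \<open>Condition (iv) appears as the requirement that the inside of the outer brackets is not
  indecomposable.\<close>

lemma indecomposable_iff: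
  "indecomposable w \<longleftrightarrow> (\<exists>u. w = enclose u \<and> u \<in> RB_words \<and> u \<noteq> [] \<and> \<not> indecomposable u)"
proof
  assume w: "indecomposable w"
  then have m: "matched w 0 (length w - 1)" and ne: "w \<noteq> []" "hd w = LB" "last w = RB"
    by (auto simp: indecomposable_def bracketed_iff)
  define u where "u = take (length w - 2) (drop 1 w)"
  have "balanced u"
    using m by (simp add: matched_def u_def numeral_2_eq_2)
  moreover have "w = enclose u"
  proof -
    obtain w' where w': "w = LB # w'" using ne by (cases w) auto
    with m have "w' \<noteq> []" by (auto simp: matched_def)
    then obtain w'' where "w' = w'' @ [RB]"
      using ne w' by (cases w' rule: rev_cases) auto
    then show ?thesis using w' by (simp add: u_def enclose_def)
  qed
  ultimately show "\<exists>u. w = enclose u \<and> u \<in> RB_words \<and> u \<noteq> [] \<and> \<not> indecomposable u"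
    using w indecomposable_enclose by auto
next
  assume "\<exists>u. w = enclose u \<and> u \<in> RB_words \<and> u \<noteq> [] \<and> \<not> indecomposable u"
  then show "indecomposable w"
    using indecomposable_enclose RB_words_balanced by auto
qed

lemma indecomposable_bracketed: "indecomposable w \<Longrightarrow> bracketed w"
  by (simp add: indecomposable_def)

lemma decomposable_bracketed: "decomposable w \<Longrightarrow> bracketed w"
  by (simp add: decomposable_def)

text \<open>After the bracket that matches the first letter, a closing bracket would violate balance and an
  opening one would form the forbidden factor of a closing and an opening bracket; so an \<open>x\<close> follows,
  and the letter after it is a bracket again.\<close>

lemma decomposable_iff:
  "decomposable w \<longleftrightarrow> (\<exists>v y. w = v @ [X] @ y \<and> indecomposable v \<and> bracketed y)"
proof
  assume w: "decomposable w"
  then have w': "bracketed w" and nm: "\<not> indecomposable w"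
    by (auto simp: indecomposable_def decomposable_def)
  obtain u r where w_eq: "w = enclose u @ r" and u: "balanced u" and r: "balanced r"
    using balanced_LB_cases bracketedD[OF w'] by metis
  have r_ne: "r \<noteq> []"
    using nm w' matched_enclose[OF u, of 0 "Suc (length u)"]
    by (auto simp: w_eq indecomposable_def)
  then have last_r: "last r = RB"
    using bracketedD(5)[OF w'] by (simp add: w_eq)
  have R: "enclose u \<in> RB_words" "r \<in> RB_words" "compatible RB (hd r)"
    using bracketedD(1)[OF w'] RB_words_append[OF balanced_enclose[OF u] r] r_ne
    by (auto simp: w_eq)
  then have "hd r = X"
    using hd_balanced[OF r] r_ne by (cases "hd r") (auto simp: compatible_def)
  then obtain y where y: "r = X # y"
    using r_ne by (cases r) auto
  have "y \<noteq> []"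
    using last_r y by auto
  moreover have "y \<in> RB_words" "hd y \<noteq> X"
    using R(2) \<open>y \<noteq> []\<close> by (auto simp: y RB_words_Cons_X)
  ultimately have "bracketed y"
    using last_r hd_balanced[OF RB_words_balanced, of y] by (cases "hd y") (auto simp: bracketed_iff y)
  moreover have "indecomposable (enclose u)"
    using R(1) matched_enclose[OF u, of 0 "Suc (length u)"]
    by (simp add: indecomposable_def bracketed_iff)
  ultimately show "\<exists>v y. w = v @ [X] @ y \<and> indecomposable v \<and> bracketed y"
    using w_eq y by auto
next
  assume "\<exists>v y. w = v @ [X] @ y \<and> indecomposable v \<and> bracketed y"
  then obtain v y where w: "w = v @ [X] @ y" and v: "indecomposable v" and y: "bracketed y"
    by blast
  note v' = bracketedD[OF indecomposable_bracketed[OF v]] and y' = bracketedD[OF y]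
  have "X # y \<in> RB_words"
    using y' by (simp add: RB_words_Cons_X)
  then have "w \<in> RB_words"
    using v' y' RB_words_append[of v "X # y"] by (simp add: w compatible_def)
  then have "bracketed w"
    using v' y' by (simp add: bracketed_iff w)
  moreover have "\<not> matched w 0 (length w - 1)"
    using v' y' matched_within_balanced[of v "[X] @ y" 0 "length w - 1"] by (auto simp: w)
  ultimately show "decomposable w"
    by (simp add: decomposable_def)
qed

lemma RB_words_nonempty_cases:
  "u \<in> RB_words \<and> u \<noteq> [] \<longleftrightarrow>
     u = [X] \<or> bracketed u \<or>
     (\<exists>w. bracketed w \<and> (u = [X] @ w \<or> u = w @ [X] \<or> u = [X] @ w @ [X]))"
  (is "?L \<longleftrightarrow> ?R")
proof
  assume L: ?L
  have br: "bracketed w" if "w \<in> RB_words" "w \<noteq> []" "hd w \<noteq> X" "last w \<noteq> X" for w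
    using that hd_balanced[of w] last_balanced[of w] RB_words_balanced[of w]
    unfolding bracketed_iff by (metis letter.exhaust)
  have right: "bracketed w \<or> (\<exists>w'. bracketed w' \<and> w = w' @ [X])"
    if w: "w \<in> RB_words" "w \<noteq> []" "hd w \<noteq> X" for w
  proof (cases "last w = X")
    case True
    then obtain w' where w': "w = w' @ [X]"
      using w by (metis append_butlast_last_id)
    then have "w' \<noteq> []" using w by auto
    then show ?thesis
      using w br[of w'] RB_words_snoc_X[of w'] by (auto simp: w')
  qed (use w br in blast)
  show ?R
  proof (cases "hd u = X")
    case True
    then obtain w where u: "u = X # w"
      using L by (cases u) auto
    then have "w = [] \<or> w \<in> RB_words \<and> w \<noteq> [] \<and> hd w \<noteq> X"
      using L by (auto simp: RB_words_Cons_X)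
    then show ?thesis
      using right[of w] by (auto simp: u)
  qed (use L right in blast)
next
  assume ?R
  then show ?L
  proof (elim disjE exE conjE)
    fix w assume "bracketed w" "u = [X] @ w @ [X]"
    then show ?L
      using bracketedD[of w] RB_words_snoc_X[of w] RB_words_Cons_X[of "w @ [X]"] by auto
  qed (auto simp: RB_words_Cons_X RB_words_snoc_X bracketed_iff)
qed

lemma indecomposable_cases:
  "indecomposable w \<longleftrightarrow>
     w = enclose [X] \<or>
     (\<exists>u. bracketed u \<and>
        (w = enclose ([X] @ u) \<or> w = enclose (u @ [X]) \<or> w = enclose ([X] @ u @ [X]))) \<or>
     (\<exists>u. decomposable u \<and> w = enclose u)"
proof -
  have "\<not> indecomposable [X]" "\<not> indecomposable ([X] @ u)" "\<not> indecomposable (u @ [X])"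
    "\<not> indecomposable ([X] @ u @ [X])" for u
    by (auto simp: indecomposable_def bracketed_iff)
  then have "u \<in> RB_words \<and> u \<noteq> [] \<and> \<not> indecomposable u \<longleftrightarrow>
     u = [X] \<or> decomposable u \<or>
     (\<exists>w. bracketed w \<and> (u = [X] @ w \<or> u = w @ [X] \<or> u = [X] @ w @ [X]))" for u
    using RB_words_nonempty_cases[of u] bracketed_cases[of u] indecomposable_not_decomposable[of u]
    by metis
  then show ?thesis
    unfolding indecomposable_iff[of w] by (simp only: conj_assoc) blast
qed

lemma decomposable_cases:
  "decomposable w \<longleftrightarrow>
     (\<exists>y. bracketed y \<and>
       (w = enclose [X] @ [X] @ y \<or>
        (\<exists>u. bracketed u \<and>
           (w = enclose ([X] @ u) @ [X] @ y \<or> w = enclose (u @ [X]) @ [X] @ y \<or>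
            w = enclose ([X] @ u @ [X]) @ [X] @ y)) \<or>
        (\<exists>u. decomposable u \<and> w = enclose u @ [X] @ y)))"
  (is "_ \<longleftrightarrow> ?R")
proof
  assume "decomposable w"
  then obtain v y where "w = v @ [X] @ y" "indecomposable v" "bracketed y"
    unfolding decomposable_iff by blast
  then show ?R
    unfolding indecomposable_cases by blast
next
  assume ?R
  then have "\<exists>v y. w = v @ [X] @ y \<and> indecomposable v \<and> bracketed y"
    unfolding indecomposable_cases by blast
  then show "decomposable w"
    unfolding decomposable_iff .
qed

lemma degree_simps:
  "balanced u \<Longrightarrow> degree (enclose u) = Suc (degree u)"
  "balanced u \<Longrightarrow> degree (u @ v) = degree u + degree v"
  "degree (X # v) = degree v"
  "degree [] = 0"
proof -
  have "degree [X] = 0"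
    by (simp add: degree_eq_count)
  then show "degree (X # v) = degree v"
    using degree_append[of "[X]" v] by simp
qed (auto simp: degree_enclose degree_append degree_eq_count)

text \<open>The lower bound on the arity is the delicate one. A decomposable word has an \<open>x\<close> between its factors, so its arity
  exceeds its degree; this pays for the brackets that turn it into an indecomposable word without adding an \<open>x\<close>.\<close>

lemma bracketed_bounds:
  "bracketed w \<Longrightarrow> 0 < degree w \<and> degree w \<le> arity w \<and> arity w + 1 \<le> 2 * degree w"
proof (induction w rule: length_induct)
  case (1 w)
  then have IH: "0 < degree u \<and> degree u \<le> arity u \<and> arity u + 1 \<le> 2 * degree u"
    if "bracketed u" "length u < length w" for u
    using that by blast
  from "1.prems" consider "indecomposable w" | "decomposable w"
    using bracketed_cases by blast
  then show ?case
  proof cases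
    case 1
    then consider "w = enclose [X]"
      | u where "bracketed u"
        "w = enclose ([X] @ u) \<or> w = enclose (u @ [X]) \<or> w = enclose ([X] @ u @ [X])"
      | u where "decomposable u" "w = enclose u"
      unfolding indecomposable_cases by blast
    then show ?thesis
    proof cases
      case 1
      then show ?thesis by (simp add: degree_simps)
    next
      case (2 u)
      then show ?thesis
        using IH[of u] bracketedD[of u] by (auto simp: degree_simps)
    next
      case (3 u)
      then obtain v y where u: "u = v @ [X] @ y" and v: "bracketed v" and y: "bracketed y"
        using decomposable_iff indecomposable_bracketed by blast
      moreover have "balanced u"
        using 3 decomposable_bracketed bracketedD(2) by blast
      ultimately show ?thesis
        using 3 IH[of v] IH[of y] bracketedD(2)[of v] by (simp add: degree_simps)
    qed
  next
    case 2
    then obtain v y where w: "w = v @ [X] @ y" and v: "bracketed v" and y: "bracketed y"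
      using decomposable_iff indecomposable_bracketed by blast
    then show ?thesis
      using IH[of v] IH[of y] bracketedD[of v] bracketedD[of y] by (auto simp: degree_simps)
  qed
qed

section \<open>The steps\<close>

lemma \<B>_iff: "w \<in> \<B> n m \<longleftrightarrow> bracketed w \<and> degree w = n \<and> arity w = m"
  using bracketed_bounds[of w] by (auto simp: \<B>_def)

lemma \<I>_iff: "w \<in> \<I> n m \<longleftrightarrow> indecomposable w \<and> degree w = n \<and> arity w = m"
  using bracketed_bounds[OF indecomposable_bracketed, of w] by (auto simp: \<I>_def)

lemma \<D>_iff: "w \<in> \<D> n m \<longleftrightarrow> decomposable w \<and> degree w = n \<and> arity w = m"
  using bracketed_bounds[OF decomposable_bracketed, of w] by (auto simp: \<D>_def)

lemma \<B>_eq: "\<B> n m = \<I> n m \<union> \<D> n m"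
  by (auto simp: \<B>_iff \<I>_iff \<D>_iff bracketed_cases)

lemma \<I>_\<D>_disjoint: "\<I> n m \<inter> \<D> n m = {}"
  by (auto simp: \<I>_iff \<D>_iff dest: indecomposable_not_decomposable)

lemma \<B>_empty: "\<not> (n \<le> m \<and> m + 1 \<le> 2 * n) \<Longrightarrow> \<B> n m = {}"
  using bracketed_bounds by (auto simp: \<B>_iff)

lemma UNIV_letter: "(UNIV :: letter set) = {X, LB, RB}"
  using letter.nchotomy by auto

lemma finite_\<B>: "finite (\<B> n m)"
proof (rule finite_subset)
  show "\<B> n m \<subseteq> {w. set w \<subseteq> {X, LB, RB} \<and> length w = 2 * n + m}"
    by (auto simp: \<B>_iff length_balanced[OF bracketedD(2)] simp flip: UNIV_letter)
qed (simp add: finite_lists_length_eq)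

lemma generate_eq:
  assumes "\<And>w. P w \<Longrightarrow> balanced w"
  shows "generate P n m = {w. P w \<and> degree w = n \<and> arity w = m}"
proof -
  have "set w \<subseteq> set [X, LB, RB]" for w :: word
    by (simp flip: UNIV_letter)
  then show ?thesis
    unfolding generate_def set_filter set_n_lists using length_balanced[OF assms] by auto
qed

lemma bracketed_pos:
  assumes "bracketed w"
  shows "0 < degree w" "0 < arity w"
  using bracketed_bounds[OF assms] by auto

text \<open>Bracketed words have positive degree and arity, so wherever a truncated subtraction in the
  indices of a step yields 0, the set it selects is empty and no word is formed.\<close>

lemma mem_step1:
  "w \<in> step1 \<B> n m \<longleftrightarrow> degree w = n \<and> arity w = m \<and>
     (\<exists>u. bracketed u \<and> (w = enclose ([X] @ u) \<or> w = enclose (u @ [X])))"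
  by (fastforce simp: step1_def \<B>_iff degree_simps bracketedD(2) dest: bracketed_pos)

lemma mem_step2:
  "w \<in> step2 \<B> n m \<longleftrightarrow> degree w = n \<and> arity w = m \<and>
     (\<exists>u. bracketed u \<and> w = enclose ([X] @ u @ [X]))"
  by (fastforce simp: step2_def \<B>_iff degree_simps bracketedD(2) dest: bracketed_pos)

lemma mem_step5:
  "w \<in> step5 \<B> n m \<longleftrightarrow> degree w = n \<and> arity w = m \<and>
     (\<exists>y. bracketed y \<and> w = enclose [X] @ [X] @ y)"
  by (auto simp: step5_def \<B>_iff degree_simps balanced_enclose dest: bracketed_pos)

text \<open>The common form of the steps that combine two words. The range restrictions on \<open>k\<close> and \<open>l\<close>
  only express that both words have positive degree and arity, which bracketed words always have;
  \<open>c\<close> is the number of letters \<open>x\<close> added by \<open>f\<close>.\<close>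

lemma mem_product_iff:
  assumes c: "0 < c"
    and P: "\<And>k l v. v \<in> P k l \<longleftrightarrow> p v \<and> degree v = k \<and> arity v = l"
    and br: "\<And>v. p v \<Longrightarrow> bracketed v"
    and f: "\<And>v y. bracketed v \<Longrightarrow> bracketed y \<Longrightarrow>
      degree (f v y) = degree v + degree y + 1 \<and> arity (f v y) = arity v + arity y + c"
  shows "w \<in> {f v y | k l v y. k \<in> {1..n - 2} \<and> l \<in> {1..m - Suc c} \<and>
        v \<in> P k l \<and> y \<in> \<B> (n - 1 - k) (m - c - l)} \<longleftrightarrow>
    degree w = n \<and> arity w = m \<and> (\<exists>v y. p v \<and> bracketed y \<and> w = f v y)"
    (is "w \<in> ?S \<longleftrightarrow> ?R")
proof
  assume "w \<in> ?S"
  then obtain v y where "w = f v y" "p v" "bracketed y"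
    "degree v \<in> {1..n - 2}" "arity v \<in> {1..m - Suc c}"
    "degree y = n - 1 - degree v" "arity y = m - c - arity v"
    by (auto simp: P \<B>_iff)
  then show ?R
    using br[of v] f[of v y] bracketed_pos[of y] by auto
next
  assume ?R
  then obtain v y where vy: "w = f v y" "p v" "bracketed y" and w: "degree w = n" "arity w = m"
    by blast
  then have "degree v \<in> {1..n - 2}" "arity v \<in> {1..m - Suc c}"
    "degree y = n - 1 - degree v" "arity y = m - c - arity v"
    using br[of v] f[of v y] bracketed_pos[of y] bracketed_pos[of v] by auto
  with vy show "w \<in> ?S"
    unfolding P \<B>_iff by blast
qed

lemma mem_step3:
  "w \<in> step3 \<I> \<B> n m \<longleftrightarrow> degree w = n \<and> arity w = m \<and>
     (\<exists>v y. indecomposable v \<and> bracketed y \<and> w = enclose (v @ [X] @ y))"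
  using mem_product_iff[of 1 \<I> indecomposable "\<lambda>v y. enclose (v @ [X] @ y)" w n m]
  by (simp add: step3_def \<I>_iff indecomposable_bracketed bracketedD degree_simps balanced_append
      numeral_2_eq_2)

lemma mem_step4:
  "w \<in> step4 \<D> \<B> n m \<longleftrightarrow> degree w = n \<and> arity w = m \<and>
     (\<exists>v y. decomposable v \<and> bracketed y \<and> w = enclose v @ [X] @ y)"
  using mem_product_iff[of 1 \<D> decomposable "\<lambda>v y. enclose v @ [X] @ y" w n m]
  by (simp add: step4_def \<D>_iff decomposable_bracketed bracketedD degree_simps balanced_enclose
      numeral_2_eq_2)

lemma mem_step6:
  "w \<in> step6 \<B> n m \<longleftrightarrow> degree w = n \<and> arity w = m \<and>
     (\<exists>v y. bracketed v \<and> bracketed y \<and>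
        (w = enclose ([X] @ v) @ [X] @ y \<or> w = enclose (v @ [X]) @ [X] @ y))"
  using mem_product_iff[of 2 \<B> bracketed "\<lambda>v y. enclose ([X] @ v) @ [X] @ y" w n m]
    mem_product_iff[of 2 \<B> bracketed "\<lambda>v y. enclose (v @ [X]) @ [X] @ y" w n m]
  by (simp add: step6_def \<B>_iff bracketedD degree_simps balanced_enclose numeral_3_eq_3
      numeral_2_eq_2) blast

lemma mem_step7:
  "w \<in> step7 \<B> n m \<longleftrightarrow> degree w = n \<and> arity w = m \<and>
     (\<exists>v y. bracketed v \<and> bracketed y \<and> w = enclose ([X] @ v @ [X]) @ [X] @ y)"
  using mem_product_iff[of 3 \<B> bracketed "\<lambda>v y. enclose ([X] @ v @ [X]) @ [X] @ y" w n m]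
  by (simp add: step7_def \<B>_iff bracketedD degree_simps balanced_enclose eval_nat_numeral)

lemmas mem_steps = mem_step1 mem_step2 mem_step3 mem_step4 mem_step5 mem_step6 mem_step7

text \<open>The only indecomposable word that the steps do not form is the one with a single \<open>x\<close> in
  brackets, of degree 1.\<close>

lemma \<I>_eq_steps:
  assumes "2 \<le> n"
  shows "\<I> n m = step1 \<B> n m \<union> step2 \<B> n m \<union> step3 \<I> \<B> n m"
proof -
  have "w \<noteq> enclose [X]" if "degree w = n" for w
    using that assms by (auto simp: degree_simps)
  moreover have "w \<in> step3 \<I> \<B> n m \<longleftrightarrow>
      degree w = n \<and> arity w = m \<and> (\<exists>u. decomposable u \<and> w = enclose u)" for w
    unfolding mem_step3 decomposable_iff by blast
  ultimately have "w \<in> \<I> n m \<longleftrightarrow> w \<in> step1 \<B> n m \<union> step2 \<B> n m \<union> step3 \<I> \<B> n m" for w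
    unfolding \<I>_iff indecomposable_cases[of w] Un_iff mem_step1 mem_step2 by blast
  then show ?thesis by blast
qed

lemma \<D>_eq_steps:
  "\<D> n m = step4 \<D> \<B> n m \<union> step5 \<B> n m \<union> step6 \<B> n m \<union> step7 \<B> n m"
proof -
  have "w \<in> \<D> n m \<longleftrightarrow>
      w \<in> step4 \<D> \<B> n m \<union> step5 \<B> n m \<union> step6 \<B> n m \<union> step7 \<B> n m" for w
    unfolding \<D>_iff decomposable_cases[of w] Un_iff mem_steps by blast
  then show ?thesis by blast
qed

section \<open>Correctness of the algorithm\<close>

text \<open>The induction includes degree and arity 0, because the steps may look up such indices.\<close>

lemma algorithm_correct: "algorithm n m = (\<B> n m, \<I> n m, \<D> n m)"
proof (induction n arbitrary: m rule: less_induct)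
  case (less n)
  consider "\<not> (n \<le> m \<and> m + 1 \<le> 2 * n)" | "n \<le> m \<and> m + 1 \<le> 2 * n" "n \<le> 3"
    | "n \<le> m \<and> m + 1 \<le> 2 * n" "\<not> n \<le> 3"
    by blast
  then show ?case
  proof cases
    case 1
    then have "\<B> n m = {}"
      by (rule \<B>_empty)
    then have "\<B> n m = {}" "\<I> n m = {}" "\<D> n m = {}"
      using \<B>_eq[of n m] by auto
    then show ?thesis
      unfolding algorithm.simps[of n m] if_P[OF 1] by simp
  next
    case 2
    have "generate bracketed n m = \<B> n m" "generate indecomposable n m = \<I> n m"
      "generate decomposable n m = \<D> n m"
      using bracketedD(2) indecomposable_bracketed decomposable_bracketed
      by (auto simp: generate_eq \<B>_iff \<I>_iff \<D>_iff)
    with 2 show ?thesis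
      by (simp add: algorithm.simps[of n m])
  next
    case 3
    have B: "fst (algorithm k l) = \<B> k l"
      and I: "fst (snd (algorithm k l)) = \<I> k l"
      and D: "snd (snd (algorithm k l)) = \<D> k l" if "k \<le> n - 1" for k l
      using that 3 less.IH[of k l] by simp_all
    let ?B = "\<lambda>k l. fst (algorithm k l)"
    let ?I = "\<lambda>k l. fst (snd (algorithm k l))"
    let ?D = "\<lambda>k l. snd (snd (algorithm k l))"
    have steps:
      "step1 ?B n m = step1 \<B> n m" "step2 ?B n m = step2 \<B> n m"
      "step3 ?I ?B n m = step3 \<I> \<B> n m" "step4 ?D ?B n m = step4 \<D> \<B> n m"
      "step5 ?B n m = step5 \<B> n m" "step6 ?B n m = step6 \<B> n m" "step7 ?B n m = step7 \<B> n m"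
      by (intro step1_cong step2_cong step3_cong step4_cong step5_cong step6_cong step7_cong
          refl B I D; assumption)+
    have "2 \<le> n"
      using 3 by simp
    with 3 show ?thesis
      unfolding algorithm.simps[of n m] Let_def steps \<B>_eq[of n m] \<I>_eq_steps[OF \<open>2 \<le> n\<close>, of m]
        \<D>_eq_steps[of n m] by simp
  qed
qed

section \<open>Disjointness of the steps\<close>

text \<open>The number of ends at which an \<open>x\<close> is attached to a bracketed word. The word \<open>x\<close>, whose only
  letter is at both ends, gets a value of its own.\<close>

definition end_type :: "word \<Rightarrow> nat" where
  "end_type a = (if a = [X] then 3 else of_bool (hd a = X) + of_bool (last a = X))"

lemma end_type_bracketed:
  assumes "bracketed u"
  shows "end_type u = 0" "end_type ([X] @ u) = 1" "end_type (u @ [X]) = 1"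
    "end_type ([X] @ u @ [X]) = 2"
  using bracketedD[OF assms] by (auto simp: end_type_def)

text \<open>The seven pairs are distinct, so the step that formed a word can be recovered from the word.\<close>

lemma step_shape:
  fixes n m :: nat
  defines "S \<equiv> [step1 \<B> n m, step2 \<B> n m, step3 \<I> \<B> n m, step4 \<D> \<B> n m,
      step5 \<B> n m, step6 \<B> n m, step7 \<B> n m]"
  assumes i: "i < 7" and w: "w \<in> S ! i"
  shows "\<exists>a r. w = enclose a @ r \<and> balanced a \<and> (end_type a, r = []) =
    [(1, True), (2, True), (0, True), (0, False), (3, False), (1, False), (2, False)] ! i"
proof -
  have shape: "\<exists>a r. w = enclose a @ r \<and> balanced a \<and> (end_type a, r = []) = (c, e)"
    if "w = enclose a @ r" "balanced a" "end_type a = c" "(r = []) = e" for a r c e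
    using that by blast
  consider "i = 0" | "i = 1" | "i = 2" | "i = 3" | "i = 4" | "i = 5" | "i = 6"
    using i by linarith
  then show ?thesis
  proof cases
    case 1
    then show ?thesis using w
      by (auto simp: S_def mem_steps end_type_bracketed[simplified] bracketedD intro!: shape)
  next
    case 2
    then show ?thesis using w
      by (auto simp: S_def mem_steps end_type_bracketed[simplified] bracketedD intro!: shape)
  next
    case 3
    then obtain v y where v: "indecomposable v" "bracketed y" "w = enclose (v @ [X] @ y)"
      using w by (auto simp: S_def mem_steps)
    then have "bracketed (v @ [X] @ y)"
      using decomposable_iff decomposable_bracketed by blast
    then show ?thesis
      using v 3 by (auto simp: end_type_bracketed[simplified] bracketedD intro!: shape)
  next
    case 4
    then obtain v y where v: "decomposable v" "w = enclose v @ [X] @ y"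
      using w by (auto simp: S_def mem_steps)
    then have "bracketed v"
      using decomposable_bracketed by blast
    then show ?thesis
      using v 4 shape[of v "[X] @ y" 0 False] by (simp add: end_type_bracketed bracketedD)
  next
    case 5
    then obtain y where "w = enclose [X] @ [X] @ y"
      using w by (auto simp: S_def mem_steps)
    then show ?thesis
      using 5 shape[of "[X]" "[X] @ y" 3 False] by (simp add: end_type_def)
  next
    case 6
    then obtain a v y where v: "bracketed v" "a = [X] @ v \<or> a = v @ [X]" "w = enclose a @ [X] @ y"
      using w by (simp add: S_def mem_steps) metis
    then have "balanced a" "end_type a = 1"
      using end_type_bracketed[of v] bracketedD(2)[of v] by auto
    then show ?thesis
      using v 6 shape[of a "[X] @ y" 1 False] by simp
  next
    case 7
    then obtain v y where v: "bracketed v" "w = enclose ([X] @ v @ [X]) @ [X] @ y"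
      using w by (auto simp: S_def mem_steps)
    then show ?thesis
      using 7 shape[of "[X] @ v @ [X]" "[X] @ y" 2 False] end_type_bracketed(4)[of v]
      by (simp add: bracketedD)
  qed
qed

lemma steps_disjoint:
  fixes n m :: nat
  defines "S \<equiv> [step1 \<B> n m, step2 \<B> n m, step3 \<I> \<B> n m, step4 \<D> \<B> n m,
      step5 \<B> n m, step6 \<B> n m, step7 \<B> n m]"
  shows "disjoint_family_on (\<lambda>i. S ! i) {..<7}"
  unfolding disjoint_family_on_def
proof (intro ballI impI equals0I)
  let ?key = "[(1, True), (2, True), (0, True), (0, False), (3, False), (1, False), (2, False)]
    :: (nat \<times> bool) list"
  fix i j w
  assume ij: "i \<in> {..<7}" "j \<in> {..<7}" "i \<noteq> (j :: nat)" and w: "w \<in> S ! i \<inter> S ! j"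
  obtain a r where a: "w = enclose a @ r" "balanced a" "(end_type a, r = []) = ?key ! i"
    using step_shape[of i w n m] ij w unfolding S_def by blast
  obtain b s where b: "w = enclose b @ s" "balanced b" "(end_type b, s = []) = ?key ! j"
    using step_shape[of j w n m] ij w unfolding S_def by blast
  have "a = b \<and> r = s"
    using a b enclose_append_inject by metis
  then have "?key ! i = ?key ! j"
    using a b by simp
  moreover have "distinct ?key"
    by simp
  ultimately have "i = j"
    using ij nth_eq_iff_index_eq[of ?key i j] by simp
  then show False
    using ij by simp
qed

section \<open>The recursion for the cardinalities\<close>

lemma card_product_family:
  assumes "finite K" "finite L"
    and "\<And>k l. finite (P k l)" "\<And>k l. finite (Q k l)"
    and P: "\<And>k l k' l' v. v \<in> P k l \<Longrightarrow> v \<in> P k' l' \<Longrightarrow> k = k' \<and> l = l'"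
    and f: "\<And>k l k' l' v v' y y'. v \<in> P k l \<Longrightarrow> v' \<in> P k' l' \<Longrightarrow> f v y = f v' y' \<Longrightarrow> v = v' \<and> y = y'"
  shows "card {f v y | k l v y. k \<in> K \<and> l \<in> L \<and> v \<in> P k l \<and> y \<in> Q k l} =
    (\<Sum>k\<in>K. \<Sum>l\<in>L. card (P k l) * card (Q k l))"
proof -
  let ?\<Sigma> = "SIGMA p : K \<times> L. P (fst p) (snd p) \<times> Q (fst p) (snd p)"
  let ?f = "\<lambda>(p, v, y). f v y"
  have "{f v y | k l v y. k \<in> K \<and> l \<in> L \<and> v \<in> P k l \<and> y \<in> Q k l} = ?f ` ?\<Sigma>"
    by (fastforce simp: image_iff)
  moreover have "inj_on ?f ?\<Sigma>"
  proof (rule inj_onI, clarsimp)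
    fix k l v y k' l' v' y'
    assume v: "v \<in> P k l" "v' \<in> P k' l'" and "f v y = f v' y'"
    then have "v = v' \<and> y = y'"
      using f by blast
    with v show "k = k' \<and> l = l' \<and> v = v' \<and> y = y'"
      using P by blast
  qed
  moreover have "card ?\<Sigma> = (\<Sum>p\<in>K \<times> L. card (P (fst p) (snd p)) * card (Q (fst p) (snd p)))"
    using assms by (simp add: card_cartesian_product)
  ultimately show ?thesis
    by (simp add: card_image sum.cartesian_product case_prod_unfold)
qed

text \<open>Words of different degree or arity are different, so the sets indexed by \<open>(k, l)\<close> do not
  overlap and their products can be summed.\<close>

lemma card_product_step:
  assumes P: "\<And>k l. P k l \<subseteq> \<B> k l"
    and f: "\<And>k l k' l' v v' y y'. v \<in> P k l \<Longrightarrow> v' \<in> P k' l' \<Longrightarrow> f v y = f v' y' \<Longrightarrow> v = v' \<and> y = y'"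
  shows "card {f v y | k l v y. k \<in> {1..n - 2} \<and> l \<in> {1..M} \<and> v \<in> P k l \<and>
      y \<in> \<B> (n - 1 - k) (N - l)} =
    (\<Sum>k = 1..n - 2. \<Sum>l = 1..M. card (P k l) * \<b> (n - 1 - k) (N - l))"
  unfolding \<b>_def
proof (rule card_product_family[OF _ _ _ _ _ f])
  show "k = k' \<and> l = l'" if "v \<in> P k l" "v \<in> P k' l'" for k l k' l' v
  proof -
    have "v \<in> \<B> k l" "v \<in> \<B> k' l'"
      using that P by blast+
    then show ?thesis
      by (auto simp: \<B>_iff)
  qed
qed (auto intro: finite_\<B> finite_subset[OF P])

lemma enclose_X_inject:
  assumes "balanced a" "balanced b" "enclose a @ [X] @ y = enclose b @ [X] @ y'"
  shows "a = b \<and> y = y'"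
  using assms enclose_append_inject[of a b "[X] @ y" "[X] @ y'"] by simp

lemma \<I>_subset: "\<I> k l \<subseteq> \<B> k l" and \<D>_subset: "\<D> k l \<subseteq> \<B> k l"
  by (auto simp: \<B>_eq)

lemma X_append_neq_append_X: "bracketed v \<Longrightarrow> [X] @ u \<noteq> v @ [X]"
  using bracketedD(3,4)[of v] by (cases v) auto

lemma card_step1: "card (step1 \<B> n m) = 2 * \<b> (n - 1) (m - 1)"
proof -
  let ?B = "\<B> (n - 1) (m - 1)"
  let ?f = "\<lambda>w. enclose ([X] @ w)" and ?g = "\<lambda>w. enclose (w @ [X])"
  have "step1 \<B> n m = ?f ` ?B \<union> ?g ` ?B"
    unfolding step1_def by blast
  moreover have "?f ` ?B \<inter> ?g ` ?B = {}"
    using X_append_neq_append_X by (auto simp: \<B>_iff)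
  moreover have "card (?f ` ?B) = \<b> (n - 1) (m - 1)" "card (?g ` ?B) = \<b> (n - 1) (m - 1)"
    unfolding \<b>_def by (auto intro!: card_image inj_onI)
  ultimately show ?thesis
    by (simp add: card_Un_disjoint finite_\<B>)
qed

lemma card_step2: "card (step2 \<B> n m) = \<b> (n - 1) (m - 2)"
proof -
  have "step2 \<B> n m = (\<lambda>u. enclose ([X] @ u @ [X])) ` \<B> (n - 1) (m - 2)"
    unfolding step2_def by blast
  then show ?thesis
    unfolding \<b>_def by (auto intro!: card_image inj_onI)
qed

lemma card_step3:
  "card (step3 \<I> \<B> n m) =
    (\<Sum>k = 1..n - 2. \<Sum>l = 1..m - 2. card (\<I> k l) * \<b> (n - 1 - k) (m - 1 - l))"
  unfolding step3_def
proof (rule card_product_step[OF \<I>_subset])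
  fix k l k' l' v v' y y'
  assume "v \<in> \<I> k l" "v' \<in> \<I> k' l'" and eq: "enclose (v @ [X] @ y) = enclose (v' @ [X] @ y')"
  then obtain a b where "v = enclose a" "balanced a" "v' = enclose b" "balanced b"
    using indecomposable_iff RB_words_balanced unfolding \<I>_iff by metis
  then show "v = v' \<and> y = y'"
    using eq enclose_X_inject[of a b y y'] by simp
qed

lemma card_step4:
  "card (step4 \<D> \<B> n m) =
    (\<Sum>k = 1..n - 2. \<Sum>l = 1..m - 2. card (\<D> k l) * \<b> (n - 1 - k) (m - 1 - l))"
  unfolding step4_def
  using decomposable_bracketed bracketedD(2)
  by (intro card_product_step[OF \<D>_subset] enclose_X_inject) (auto simp: \<D>_iff)

lemma card_step5: "card (step5 \<B> n m) = \<b> (n - 1) (m - 2)"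
proof -
  have "step5 \<B> n m = (\<lambda>u. enclose [X] @ [X] @ u) ` \<B> (n - 1) (m - 2)"
    unfolding step5_def by blast
  then show ?thesis
    unfolding \<b>_def by (auto intro!: card_image inj_onI)
qed

lemma card_step6:
  "card (step6 \<B> n m) =
    2 * (\<Sum>k = 1..n - 2. \<Sum>l = 1..m - 3. \<b> k l * \<b> (n - 1 - k) (m - 2 - l))"
proof -
  \<comment> \<open>The two halves of the step differ only in the side \<open>g\<close> on which the \<open>x\<close> is attached.\<close>
  define F where "F g = {enclose (g v) @ [X] @ y | k l v y.
      k \<in> {1..n - 2} \<and> l \<in> {1..m - 3} \<and> v \<in> \<B> k l \<and> y \<in> \<B> (n - 1 - k) (m - 2 - l)}"
    for g :: "word \<Rightarrow> word"
  have card_F: "card (F g) = (\<Sum>k = 1..n - 2. \<Sum>l = 1..m - 3. \<b> k l * \<b> (n - 1 - k) (m - 2 - l))"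
    if g: "\<And>v. bracketed v \<Longrightarrow> balanced (g v)" "inj g" for g
    unfolding F_def \<b>_def[of _ "_ :: nat", symmetric]
  proof (subst card_product_step[OF order.refl])
    fix k l k' l' v v' y y'
    assume "v \<in> \<B> k l" "v' \<in> \<B> k' l'" "enclose (g v) @ [X] @ y = enclose (g v') @ [X] @ y'"
    then show "v = v' \<and> y = y'"
      using enclose_X_inject[of "g v" "g v'" y y'] g unfolding \<B>_iff inj_def by blast
  qed (simp add: \<b>_def)
  have "step6 \<B> n m = F (\<lambda>v. [X] @ v) \<union> F (\<lambda>v. v @ [X])"
    unfolding step6_def F_def ..
  moreover have "F (\<lambda>v. [X] @ v) \<inter> F (\<lambda>v. v @ [X]) = {}"
  proof (rule equals0I)
    fix w assume "w \<in> F (\<lambda>v. [X] @ v) \<inter> F (\<lambda>v. v @ [X])"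
    then obtain u v y z where uv: "bracketed u" "bracketed v"
      and "enclose ([X] @ u) @ [X] @ y = enclose (v @ [X]) @ [X] @ z"
      unfolding F_def \<B>_iff by blast
    then have "[X] @ u = v @ [X]"
      using enclose_X_inject[of "[X] @ u" "v @ [X]" y z] by (simp add: bracketedD(2))
    then show False
      using X_append_neq_append_X[OF uv(2)] by simp
  qed
  moreover have "finite (F g)" if "F g \<subseteq> step6 \<B> n m" for g
    using that \<D>_eq_steps[of n m] \<D>_subset[of n m] finite_\<B>[of n m]
    by (metis finite_subset Un_upper1 Un_upper2 order_trans)
  ultimately have "card (step6 \<B> n m) = card (F (\<lambda>v. [X] @ v)) + card (F (\<lambda>v. v @ [X]))"
    by (metis Un_upper1 Un_upper2 card_Un_disjoint)
  then show ?thesis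
    by (simp add: card_F bracketedD inj_def)
qed

lemma card_step7:
  "card (step7 \<B> n m) =
    (\<Sum>k = 1..n - 2. \<Sum>l = 1..m - 4. \<b> k l * \<b> (n - 1 - k) (m - 3 - l))"
  unfolding step7_def
proof (subst card_product_step[OF order.refl])
  fix k l k' l' v v' y y'
  assume "v \<in> \<B> k l" "v' \<in> \<B> k' l'"
    "enclose ([X] @ v @ [X]) @ [X] @ y = enclose ([X] @ v' @ [X]) @ [X] @ y'"
  then show "v = v' \<and> y = y'"
    using enclose_X_inject[of "[X] @ v @ [X]" "[X] @ v' @ [X]"]
    by (auto simp: \<B>_iff dest: bracketedD)
qed (simp add: \<b>_def)

lemma \<b>_eq_card_sum: "\<b> k l = card (\<I> k l) + card (\<D> k l)"
  unfolding \<b>_def \<B>_eq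
  by (intro card_Un_disjoint \<I>_\<D>_disjoint finite_subset[OF \<I>_subset] finite_subset[OF \<D>_subset]
      finite_\<B>)

lemma card_step3_step4:
  "card (step3 \<I> \<B> n m) + card (step4 \<D> \<B> n m) =
    (\<Sum>k = 1..n - 2. \<Sum>l = 1..m - 2. \<b> k l * \<b> (n - 1 - k) (m - 1 - l))"
  unfolding card_step3 card_step4 sum.distrib[symmetric]
  by (simp add: \<b>_eq_card_sum add_mult_distrib)

theorem theorem3p4:
  fixes n m :: nat
  assumes "0 < n" and "0 < m"
  shows "algorithm n m = (\<B> n m, \<I> n m, \<D> n m) \<and>
    (4 \<le> n \<longrightarrow>
      (\<forall>k<n. \<forall>l<m. \<B> k l = \<I> k l \<union> \<D> k l) \<and>
      (let S = [step1 \<B> n m, step2 \<B> n m, step3 \<I> \<B> n m, step4 \<D> \<B> n m,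
                step5 \<B> n m, step6 \<B> n m, step7 \<B> n m]
       in \<B> n m = (\<Union>i<7. S ! i) \<and> disjoint_family_on (\<lambda>i. S ! i) {..<7}) \<and>
      \<b> n m =
        2 * \<b> (n - 1) (m - 1) + 2 * \<b> (n - 1) (m - 2)
        + (\<Sum>k = 1..n - 2. \<Sum>l = 1..m - 2. \<b> k l * \<b> (n - 1 - k) (m - 1 - l))
        + 2 * (\<Sum>k = 1..n - 2. \<Sum>l = 1..m - 3. \<b> k l * \<b> (n - 1 - k) (m - 2 - l))
        + (\<Sum>k = 1..n - 2. \<Sum>l = 1..m - 4. \<b> k l * \<b> (n - 1 - k) (m - 3 - l)))"
proof (intro conjI impI)
  show "algorithm n m = (\<B> n m, \<I> n m, \<D> n m)"
    by (rule algorithm_correct)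
  assume n: "4 \<le> n"
  show "\<forall>k<n. \<forall>l<m. \<B> k l = \<I> k l \<union> \<D> k l"
    by (simp add: \<B>_eq)
  define S where "S = [step1 \<B> n m, step2 \<B> n m, step3 \<I> \<B> n m, step4 \<D> \<B> n m,
      step5 \<B> n m, step6 \<B> n m, step7 \<B> n m]"
  have seven: "{..<7 :: nat} = {0, 1, 2, 3, 4, 5, 6}"
    by auto
  have B: "\<B> n m = (\<Union>i<7. S ! i)"
    using n unfolding \<B>_eq[of n m] \<D>_eq_steps[of n m]
    by (simp add: \<I>_eq_steps[of n m] seven S_def Un_assoc)
  have disj: "disjoint_family_on (\<lambda>i. S ! i) {..<7}"
    unfolding S_def by (rule steps_disjoint)
  show "let S = [step1 \<B> n m, step2 \<B> n m, step3 \<I> \<B> n m, step4 \<D> \<B> n m,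
                step5 \<B> n m, step6 \<B> n m, step7 \<B> n m]
       in \<B> n m = (\<Union>i<7. S ! i) \<and> disjoint_family_on (\<lambda>i. S ! i) {..<7}"
    using B disj unfolding S_def Let_def by blast
  have "finite (S ! i)" if "i < 7" for i
    using that B finite_\<B>[of n m] by (auto intro: finite_subset)
  then have "\<b> n m = (\<Sum>i<7. card (S ! i))"
    unfolding \<b>_def B using disj by (intro card_UN_disjoint) (auto simp: disjoint_family_on_def)
  also have "\<dots> = card (step1 \<B> n m) + card (step2 \<B> n m)
      + (card (step3 \<I> \<B> n m) + card (step4 \<D> \<B> n m))
      + card (step5 \<B> n m) + card (step6 \<B> n m) + card (step7 \<B> n m)"
    by (simp add: seven S_def)
  finally show "\<b> n m =
        2 * \<b> (n - 1) (m - 1) + 2 * \<b> (n - 1) (m - 2)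
        + (\<Sum>k = 1..n - 2. \<Sum>l = 1..m - 2. \<b> k l * \<b> (n - 1 - k) (m - 1 - l))
        + 2 * (\<Sum>k = 1..n - 2. \<Sum>l = 1..m - 3. \<b> k l * \<b> (n - 1 - k) (m - 2 - l))
        + (\<Sum>k = 1..n - 2. \<Sum>l = 1..m - 4. \<b> k l * \<b> (n - 1 - k) (m - 3 - l))"
    unfolding card_step3_step4 card_step1 card_step2 card_step5 card_step6 card_step7 by simp
qed

end
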